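(* Let $M$ be a Riemannian manifold, let $\Psi=\{\Psi_t\}_{t\in\mathbb{R}}$ be a measurable flow on $M$ and let $\nu$ be a $\Psi$-invariant probability measure on $M$. Let $N\in\mathbb{N}$, let $f:M\to\mathbb{R}^N$ be a measurable observation and let $\rho$ be an escape function (for $f$ and $\nu$). Then for $\nu$-almost every $x\in M$ \[\underline{R}^{\Psi,f}_\rho(x)\leq\liminf_{r\to0}\left(\frac{\log f_\star\nu\left(B\left(f(x),r\right)\right)}{\log r}-\frac{\log \rho_r(f(x))}{\log r}\right)\] and \[\overline{R}^{\Psi,f}_\rho(x)\leq\limsup_{r\to0}\left(\frac{\log f_\star\nu\left(B\left(f(x),r\right)\right)}{\log r}-\frac{\log \rho_r(f(x))}{\log r}\right).\]
   Context: $f_\star\nu$ is the push-forward measure on $\mathbb{R}^N$. An escape function is a function $\rho:(r,z)\mapsto\rho_r(z)$ (for $r>0$, $z\in\mathbb{R}^N$, with nonnegative real values, positive for small $r$ so that logarithms make sense) such that: for all $0<\xi_1<1$, all $\xi_2>1$, all $\varepsilon>0$ and for $f_\star\nu$-almost every $z_1\in\mathbb{R}^N$, there exists $\zeta>0$ such that if $r<\zeta$, then for $f_\star\nu$-almost every $z_2\in B(z_1,\min\{(1-\xi_1)r,(\xi_2-1)r\})$ we have \[r^{\varepsilon}\rho_{\xi_1r}(z_2)\leq\rho_r(z_1)\leq\rho_{\xi_2 r}(z_2)\,r^{-\varepsilon}.\] The return time for the observation with respect to $\rho$ is \[\tau_{r,\rho}^{\Psi,f}(x)=\inf\{t>\rho_r(f(x)):f(\Psi_t(x))\in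 B(f(x),r)\},\] where $B(f(x),r)$ is the ball in $\mathbb{R}^N$, and the recurrence rates with respect to $\rho$ are \[\underline{R}^{\Psi,f}_\rho(x)=\liminf_{r\to0}\frac{\log\tau_{r,\rho}^{\Psi,f}(x)}{-\log r},\qquad\overline{R}^{\Psi,f}_\rho(x)=\limsup_{r\to0}\frac{\log\tau_{r,\rho}^{\Psi,f}(x)}{-\log r}.\] *)

theory Defs
  imports "HOL-Analysis.Analysis" "HOL-Probability.Probability"
begin

section \<open>Riemannian manifolds\<close>

text \<open>The set \<open>S\<close> is meant to be open: derivatives are taken at its points without restriction.\<close>

fun Ck_on :: "nat \<Rightarrow> 'a::real_normed_vector set \<Rightarrow> ('a \<Rightarrow> 'b::real_normed_vector) \<Rightarrow> bool" where
  "Ck_on 0 S h \<longleftrightarrow> continuous_on S h"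
| "Ck_on (Suc k) S h \<longleftrightarrow>
     (\<forall>x\<in>S. h differentiable (at x)) \<and> (\<forall>v. Ck_on k S (\<lambda>x. frechet_derivative h (at x) v))"

definition smooth_on :: "'a::real_normed_vector set \<Rightarrow> ('a \<Rightarrow> 'b::real_normed_vector) \<Rightarrow> bool" where
  "smooth_on S h \<longleftrightarrow> (\<forall>k. Ck_on k S h)"

text \<open>A chart is a pair of a domain and a coordinate map; the map is only relevant on the domain.\<close>

type_synonym ('m, 'd) chart = "'m set \<times> ('m \<Rightarrow> real ^ 'd)"

definition transition ::
    "('m, 'd::finite) chart \<Rightarrow> ('m, 'd) chart \<Rightarrow> real ^ 'd \<Rightarrow> real ^ 'd" where
  "transition c c' = snd c' \<circ> inv_into (fst c) (snd c)"

definition smooth_atlas :: "('m::topological_space, 'd::finite) chart set \<Rightarrow> bool" where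
  "smooth_atlas A \<longleftrightarrow>
     (\<Union>(fst ` A) = UNIV) \<and>
     (\<forall>(U, \<phi>)\<in>A. open U \<and> open (\<phi> ` U) \<and> (\<exists>\<psi>. homeomorphism U (\<phi> ` U) \<phi> \<psi>)) \<and>
     (\<forall>c\<in>A. \<forall>c'\<in>A. smooth_on (snd c ` (fst c \<inter> fst c')) (transition c c'))"

text \<open>A Riemannian metric is given by its coordinate expressions: \<open>g c y\<close> is the inner product
  in the chart \<open>c\<close> at the point with coordinates \<open>y\<close>. The last condition is the transformation
  law of a covariant 2-tensor under a change of charts, so that the local expressions define one
  inner product on each tangent space.\<close>

definition riemannian_metric ::
    "('m::topological_space, 'd::finite) chart set \<Rightarrow>
     (('m, 'd) chart \<Rightarrow> real ^ 'd \<Rightarrow> real ^ 'd \<Rightarrow> real ^ 'd \<Rightarrow> real) \<Rightarrow> bool" where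
  "riemannian_metric A g \<longleftrightarrow>
     (\<forall>c\<in>A. \<forall>y\<in>snd c ` fst c.
        bilinear (g c y) \<and> (\<forall>v w. g c y v w = g c y w v) \<and> (\<forall>v. v \<noteq> 0 \<longrightarrow> 0 < g c y v v)) \<and>
     (\<forall>c\<in>A. \<forall>v w. smooth_on (snd c ` fst c) (\<lambda>y. g c y v w)) \<and>
     (\<forall>c\<in>A. \<forall>c'\<in>A. \<forall>y\<in>snd c ` (fst c \<inter> fst c'). \<forall>v w.
        g c y v w =
          g c' (transition c c' y) (frechet_derivative (transition c c') (at y) v)
                                   (frechet_derivative (transition c c') (at y) w))"

text \<open>The manifold is the whole type \<open>'m\<close>; the class constraints are the Hausdorff property and
  second countability.\<close>

definition riemannian_manifold ::
    "('m::{t2_space, second_countable_topology}, 'd::finite) chart set \<Rightarrow>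
     (('m, 'd) chart \<Rightarrow> real ^ 'd \<Rightarrow> real ^ 'd \<Rightarrow> real ^ 'd \<Rightarrow> real) \<Rightarrow> bool" where
  "riemannian_manifold A g \<longleftrightarrow> smooth_atlas A \<and> riemannian_metric A g"


section \<open>Measurable flows\<close>

definition measurable_flow :: "(real \<Rightarrow> 'm::topological_space \<Rightarrow> 'm) \<Rightarrow> bool" where
  "measurable_flow \<Psi> \<longleftrightarrow>
     (\<forall>x. \<Psi> 0 x = x) \<and>
     (\<forall>s t x. \<Psi> (s + t) x = \<Psi> s (\<Psi> t x)) \<and>
     (\<lambda>(t, x). \<Psi> t x) \<in> borel \<Otimes>\<^sub>M borel \<rightarrow>\<^sub>M borel"

definition flow_invariant ::
    "(real \<Rightarrow> 'm::topological_space \<Rightarrow> 'm) \<Rightarrow> 'm measure \<Rightarrow> bool" where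
  "flow_invariant \<Psi> \<nu> \<longleftrightarrow> (\<forall>t. distr \<nu> \<nu> (\<Psi> t) = \<nu>)"


section \<open>Escape functions and recurrence rates\<close>

text \<open>Here \<open>\<mu>\<close> is the image of the invariant measure under the observation.\<close>

definition escape_function ::
    "(real ^ 'n) measure \<Rightarrow> (real \<Rightarrow> real ^ 'n::finite \<Rightarrow> real) \<Rightarrow> bool" where
  "escape_function \<mu> \<rho> \<longleftrightarrow>
     (\<forall>r>0. \<forall>z. 0 \<le> \<rho> r z) \<and>
     (\<forall>z. \<forall>\<^sub>F r in at_right 0. 0 < \<rho> r z) \<and>
     (\<forall>\<xi>\<^sub>1 \<xi>\<^sub>2 \<epsilon>. 0 < \<xi>\<^sub>1 \<and> \<xi>\<^sub>1 < 1 \<and> 1 < \<xi>\<^sub>2 \<and> 0 < \<epsilon> \<longrightarrow>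
        (AE z\<^sub>1 in \<mu>. \<exists>\<zeta>>0. \<forall>r. 0 < r \<and> r < \<zeta> \<longrightarrow>
           (AE z\<^sub>2 in \<mu>. z\<^sub>2 \<in> ball z\<^sub>1 (min ((1 - \<xi>\<^sub>1) * r) ((\<xi>\<^sub>2 - 1) * r)) \<longrightarrow>
              r powr \<epsilon> * \<rho> (\<xi>\<^sub>1 * r) z\<^sub>2 \<le> \<rho> r z\<^sub>1 \<and>
              \<rho> r z\<^sub>1 \<le> \<rho> (\<xi>\<^sub>2 * r) z\<^sub>2 * r powr (- \<epsilon>))))"

text \<open>The infimum is taken in \<open>ereal\<close>, so it is \<open>\<infinity>\<close> if there is no return.\<close>

definition return_time ::
    "(real \<Rightarrow> 'm \<Rightarrow> 'm) \<Rightarrow> ('m \<Rightarrow> real ^ 'n::finite) \<Rightarrow> (real \<Rightarrow> real ^ 'n \<Rightarrow> real) \<Rightarrow>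
     real \<Rightarrow> 'm \<Rightarrow> ereal" where
  "return_time \<Psi> f \<rho> r x = (INF t\<in>{t. \<rho> r (f x) < t \<and> f (\<Psi> t x) \<in> ball (f x) r}. ereal t)"

text \<open>The logarithm on \<open>[0, \<infinity>]\<close>, with \<open>log 0 = -\<infinity>\<close> and \<open>log \<infinity> = \<infinity>\<close>.\<close>

definition elog :: "ereal \<Rightarrow> ereal" where
  "elog a = (if a \<le> 0 then -\<infinity> else if a = \<infinity> then \<infinity> else ereal (ln (real_of_ereal a)))"

definition lower_recurrence_rate ::
    "(real \<Rightarrow> 'm \<Rightarrow> 'm) \<Rightarrow> ('m \<Rightarrow> real ^ 'n::finite) \<Rightarrow> (real \<Rightarrow> real ^ 'n \<Rightarrow> real) \<Rightarrow>
     'm \<Rightarrow> ereal" where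
  "lower_recurrence_rate \<Psi> f \<rho> x =
     Liminf (at_right 0) (\<lambda>r. elog (return_time \<Psi> f \<rho> r x) / ereal (- ln r))"

definition upper_recurrence_rate ::
    "(real \<Rightarrow> 'm \<Rightarrow> 'm) \<Rightarrow> ('m \<Rightarrow> real ^ 'n::finite) \<Rightarrow> (real \<Rightarrow> real ^ 'n \<Rightarrow> real) \<Rightarrow>
     'm \<Rightarrow> ereal" where
  "upper_recurrence_rate \<Psi> f \<rho> x =
     Limsup (at_right 0) (\<lambda>r. elog (return_time \<Psi> f \<rho> r x) / ereal (- ln r))"

end

theory Submission
  imports Defs
begin

text \<open>A maximal inequality makes the bound independent of how large \<open>\<rho>\<close> is. If a point of a set
  \<open>A\<close> does not return to \<open>A\<close> during \<open>(a, T]\<close>, its orbit spends at most the fraction \<open>a / T\<close> of the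
  time up to \<open>T\<close> in \<open>A\<close>, and the points of \<open>A\<close> for which some initial orbit segment visits \<open>A\<close> with
  frequency at most \<open>\<theta>\<close> form a set of measure at most \<open>\<theta>\<close>, whatever the length of the segment.
  Take for \<open>A\<close> the preimage of a grid cell of diameter comparable to \<open>r\<close>, and for \<open>\<theta>\<close> the number
  \<open>r\<^sup>\<epsilon>\<close> times the measure of a neighbourhood of the cell that contains the \<open>r\<close>-balls around its
  points. The neighbourhoods overlap boundedly often, so summing over the cells bounds the points with
  \<open>\<tau> > r\<^sup>-\<^sup>\<epsilon> \<rho> / \<mu> (B (f x) r)\<close> by a multiple of \<open>r\<^sup>\<epsilon>\<close>, simultaneously for all radii in a dyadic
  interval. Borel-Cantelli along dyadic scales concludes.\<close>

section \<open>Maximal inequality for a measure-preserving map\<close>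

text \<open>The orbit is cut greedily: at a visit to \<open>B\<close> skip the segment of length \<open>n\<close> in which \<open>A\<close> is
  rarely visited, otherwise advance by one step. Only the last segment can overshoot \<open>L\<close>, by at
  most \<open>N\<close>.\<close>

lemma sum_visits_le:
  fixes T :: "'a \<Rightarrow> 'a" and \<theta> :: real
  assumes "0 \<le> \<theta>"
    and B: "\<And>y. y \<in> B \<Longrightarrow> \<exists>n>0. n \<le> N \<and> (\<Sum>j<n. indicator A ((T ^^ j) y)) \<le> \<theta> * real n"
    and "B \<subseteq> A"
  shows "(\<Sum>j<L. indicator B ((T ^^ j) x)) \<le> \<theta> * (real L + real N)"
proof (induction L arbitrary: x rule: less_induct)
  case (less L)
  show ?case
  proof (cases "L = 0")
    case True
    then show ?thesis using assms(1) by simp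
  next
    case False
    have BA: "indicator B y \<le> (indicator A y :: real)" for y
      using \<open>B \<subseteq> A\<close> by (auto simp: indicator_def)
    have ind: "(\<Sum>j<L. indicator B ((T ^^ j) x)) \<le> \<theta> * (real L + real N)"
      if "0 < n" "n \<le> L" "(\<Sum>j<n. indicator B ((T ^^ j) x)) \<le> \<theta> * real n" for n
    proof -
      have "(\<Sum>j<L. indicator B ((T ^^ j) x))
          = (\<Sum>j<n. indicator B ((T ^^ j) x)) + (\<Sum>j=n..<L. indicator B ((T ^^ j) x) :: real)"
        using sum.atLeastLessThan_concat[of 0 n L "\<lambda>j. indicator B ((T ^^ j) x) :: real"] that(2)
        by (simp add: lessThan_atLeast0)
      also have "(\<Sum>j=n..<L. indicator B ((T ^^ j) x))
          = (\<Sum>j<L - n. indicator B ((T ^^ j) ((T ^^ n) x)) :: real)"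
        using sum.shift_bounds_nat_ivl[of "\<lambda>j. indicator B ((T ^^ j) x) :: real" 0 n "L - n"] that(2)
        by (simp add: lessThan_atLeast0 funpow_add)
      also have "\<dots> \<le> \<theta> * (real (L - n) + real N)"
        by (rule less.IH) (use that in simp)
      finally show ?thesis
        using that by (simp add: of_nat_diff algebra_simps)
    qed
    show ?thesis
    proof (cases "x \<in> B")
      case False
      then show ?thesis
        using ind[of 1] \<open>L \<noteq> 0\<close> assms(1) by simp
    next
      case True
      then obtain n where n: "0 < n" "n \<le> N" "(\<Sum>j<n. indicator A ((T ^^ j) x)) \<le> \<theta> * real n"
        using B by blast
      have n': "(\<Sum>j<n. indicator B ((T ^^ j) x)) \<le> \<theta> * real n"
        using sum_mono[OF BA, of "\<lambda>j. (T ^^ j) x" "{..<n}"] n(3) by linarith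
      show ?thesis
      proof (cases "n \<le> L")
        case True
        then show ?thesis using ind n n' by blast
      next
        case False
        have "(\<Sum>j<L. indicator B ((T ^^ j) x)) \<le> (\<Sum>j<n. indicator B ((T ^^ j) x) :: real)"
          using False by (intro sum_mono2) auto
        also have "\<dots> \<le> \<theta> * real n" by (rule n')
        also have "\<dots> \<le> \<theta> * (real L + real N)"
          using n(2) assms(1) by (intro mult_left_mono) auto
        finally show ?thesis .
      qed
    qed
  qed
qed

lemma measure_preserving_funpow:
  assumes T: "T \<in> measurable M M" and "distr M M T = M"
  shows "distr M M (T ^^ n) = M"
proof (induction n)
  case 0
  show ?case by (simp add: distr_id2)
next
  case (Suc n)
  have "distr M M (T ^^ Suc n) = distr (distr M M (T ^^ n)) M T"
    using T by (simp add: distr_distr measurable_compose_n)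
  then show ?case using Suc assms(2) by (simp add: o_def)
qed

text \<open>By invariance an indicator has the same integral along every iterate. Integrating the
  pointwise bound of \<open>sum_visits_le\<close> over orbit pieces of length \<open>L\<close> and
  dividing by \<open>L\<close> therefore makes the overshoot term vanish as \<open>L\<close>
  grows.\<close>

lemma (in prob_space) prob_sparse_visits_le:
  fixes \<theta> :: real
  assumes T [measurable]: "T \<in> measurable M M" and inv: "distr M M T = M"
    and A [measurable]: "A \<in> sets M" and "0 \<le> \<theta>"
  defines "U \<equiv> {x \<in> A. \<exists>n>0. (\<Sum>j<n. indicator A ((T ^^ j) x)) \<le> \<theta> * real n}"
  shows "U \<in> sets M" and "prob U \<le> \<theta>"
proof -
  have [measurable]: "(T ^^ j) \<in> measurable M M" for j
    by (rule measurable_compose_n) fact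
  \<comment> \<open>Capping the segment length at \<open>N\<close> keeps the overshoot bounded while
    \<open>L\<close> tends to infinity; the cap is removed at the end by continuity from
    below.\<close>
  define B where "B N = {x \<in> A. \<exists>n\<in>{0<..N}. (\<Sum>j<n. indicator A ((T ^^ j) x)) \<le> \<theta> * real n}" for N
  have Bm [measurable]: "B N \<in> sets M" for N
  proof -
    have "B N = {x \<in> space M. x \<in> A \<and> (\<exists>n\<in>{0<..N}. (\<Sum>j<n. indicator A ((T ^^ j) x)) \<le> \<theta> * real n)}"
      using sets.sets_into_space[OF A] by (auto simp: B_def)
    also have "\<dots> \<in> sets M" by measurable
    finally show ?thesis .
  qed
  have U: "U = (\<Union>N. B N)"
    by (fastforce simp: U_def B_def)
  then show "U \<in> sets M" by simp
  have le: "prob (B N) \<le> \<theta>" for N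
  proof -
    have "real L * prob (B N) \<le> \<theta> * real L + \<theta> * real N" for L
    proof -
      have eq: "(\<integral>x. (indicator (B N) ((T ^^ j) x) :: real) \<partial>M) = prob (B N)" for j
      proof -
        have "(\<integral>x. (indicator (B N) ((T ^^ j) x) :: real) \<partial>M) = (\<integral>x. indicator (B N) x \<partial>distr M M (T ^^ j))"
          by (rule integral_distr[symmetric]) simp_all
        also have "\<dots> = prob (B N)"
          using sets.sets_into_space[OF Bm] by (simp add: measure_preserving_funpow[OF T inv] Int_absorb2)
        finally show ?thesis .
      qed
      have int: "integrable M (\<lambda>x. indicator (B N) ((T ^^ j) x) :: real)" for j
        by (rule integrable_const_bound[where B = 1]) (auto simp: indicator_def)
      have "real L * prob (B N) = (\<integral>x. (\<Sum>j<L. indicator (B N) ((T ^^ j) x)) \<partial>M)"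
        using int by (simp add: eq)
      also have "\<dots> \<le> (\<integral>x. \<theta> * (real L + real N) \<partial>M)"
        using int
        by (intro integral_mono sum_visits_le[OF \<open>0 \<le> \<theta>\<close>, where A = A]) (auto simp: B_def)
      finally show ?thesis by (simp add: prob_space algebra_simps)
    qed
    then have ev: "prob (B N) \<le> \<theta> + \<theta> * real N / real L" if "L > 0" for L
      using that by (simp add: field_simps)
    have "(\<lambda>L. \<theta> + \<theta> * real N / real L) \<longlonglongrightarrow> \<theta> + 0"
      by (intro tendsto_intros lim_const_over_n)
    moreover have "\<exists>m. \<forall>L\<ge>m. prob (B N) \<le> \<theta> + \<theta> * real N / real L"
      by (rule exI[of _ 1]) (use ev in auto)
    ultimately have "prob (B N) \<le> \<theta> + 0"
      by (rule LIMSEQ_le_const)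
    then show ?thesis by simp
  qed
  have "incseq B" by (rule monoI) (force simp: B_def)
  then have "(\<lambda>N. prob (B N)) \<longlonglongrightarrow> prob U"
    unfolding U by (intro finite_Lim_measure_incseq) auto
  then show "prob U \<le> \<theta>"
    by (rule LIMSEQ_le_const2) (use le in auto)
qed

section \<open>From maps to flows\<close>

text \<open>Only the times \<open>j / Suc m\<close> are sampled. The bad set is a limit inferior over the step sizes
  because \<open>a\<close> may depend on \<open>x\<close>, and the step has to be at most \<open>a\<close> for the sampling to detect that
  there is no return.\<close>

lemma flow_return_outside_small_set:
  fixes \<Psi> :: "real \<Rightarrow> 'a \<Rightarrow> 'a" and \<theta> :: real
  assumes "prob_space M" and \<Psi>: "\<And>t. \<Psi> t \<in> measurable M M" and inv: "\<And>t. distr M M (\<Psi> t) = M"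
    and \<Psi>0: "\<And>x. \<Psi> 0 x = x" and \<Psi>add: "\<And>s t x. \<Psi> (s + t) x = \<Psi> s (\<Psi> t x)"
    and A: "A \<in> sets M" and "0 \<le> \<theta>"
  obtains V where "V \<in> sets M" "V \<subseteq> A" "emeasure M V \<le> ennreal (2 * \<theta>)"
    "\<And>x a t\<^sub>0. x \<in> A - V \<Longrightarrow> 0 < a \<Longrightarrow> a \<le> \<theta> * t\<^sub>0 \<Longrightarrow> \<exists>t. a < t \<and> t \<le> t\<^sub>0 \<and> \<Psi> t x \<in> A"
proof -
  interpret prob_space M by fact
  define \<delta> :: "nat \<Rightarrow> real" where "\<delta> m = 1 / real (Suc m)" for m
  \<comment> \<open>The factor 2 absorbs rounding: at most \<open>a / \<delta> m + 1\<close> sampled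
    times lie in [0, a], and this is at most \<open>2 * (a / \<delta> m)\<close> once
    \<open>\<delta> m \<le> a\<close>.\<close>
  define U where "U m = {x \<in> A. \<exists>n>0. (\<Sum>j<n. indicator A ((\<Psi> (\<delta> m) ^^ j) x)) \<le> (2 * \<theta>) * real n}" for m
  have "0 \<le> 2 * \<theta>" using \<open>0 \<le> \<theta>\<close> by simp
  note sparse = prob_sparse_visits_le[OF \<Psi> inv A this]
  have Um [measurable]: "U m \<in> sets M" and Ule: "prob (U m) \<le> 2 * \<theta>" for m
    unfolding U_def by (rule sparse)+
  have pow: "(\<Psi> s ^^ j) x = \<Psi> (real j * s) x" for s j x
    by (induction j) (simp_all add: \<Psi>0 distrib_right \<Psi>add)
  define V where "V = (\<Union>m. \<Inter>l\<in>{m..}. U l)"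
  have Vm: "V \<in> sets M" unfolding V_def by measurable
  moreover have "V \<subseteq> A" by (auto simp: V_def U_def)
  moreover have "emeasure M V \<le> ennreal (2 * \<theta>)"
  proof -
    \<comment> \<open>Each tail intersection lies in its first set \<open>U m\<close>, and these
      intersections increase to \<open>V\<close>, so the bound passes to the limit without a sum
      over step sizes.\<close>
    have "emeasure M (\<Inter>l\<in>{m..}. U l) \<le> ennreal (2 * \<theta>)" for m
    proof -
      have "emeasure M (\<Inter>l\<in>{m..}. U l) \<le> emeasure M (U m)"
        by (intro emeasure_mono) auto
      also have "\<dots> \<le> ennreal (2 * \<theta>)"
        using Ule[of m] by (simp add: emeasure_eq_measure ennreal_leI)
      finally show ?thesis .
    qed
    moreover have "(SUP m. emeasure M (\<Inter>l\<in>{m..}. U l)) = emeasure M V"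
      unfolding V_def by (rule SUP_emeasure_incseq) (auto simp: incseq_def)
    ultimately show ?thesis by (metis SUP_least)
  qed
  moreover have "\<exists>t. a < t \<and> t \<le> t\<^sub>0 \<and> \<Psi> t x \<in> A"
    if x: "x \<in> A - V" and a: "0 < a" "a \<le> \<theta> * t\<^sub>0" for x a t\<^sub>0
  proof (rule ccontr)
    assume no: "\<not> ?thesis"
    obtain m where m: "\<delta> m < a"
      using reals_Archimedean[OF a(1)] by (auto simp: \<delta>_def inverse_eq_divide)
    have "x \<in> U l" if "l \<ge> m" for l
    proof -
      have \<delta>: "0 < \<delta> l" "\<delta> l \<le> a"
      proof -
        have "\<delta> l \<le> \<delta> m" using that by (simp add: \<delta>_def frac_le)
        then show "\<delta> l \<le> a" using m by simp
      qed (simp add: \<delta>_def)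
      have t0: "0 < t\<^sub>0"
        using a \<open>0 \<le> \<theta>\<close> by (metis less_le_trans mult_nonneg_nonpos not_le)
      \<comment> \<open>\<open>n\<close> counts the sampled times in \<open>[0, t\<^sub>0]\<close>;
        the successor accounts for index 0. Below, \<open>p\<close> counts those in [0, a] in the
        same way.\<close>
      define n where "n = Suc (nat \<lfloor>t\<^sub>0 / \<delta> l\<rfloor>)"
      have n: "real (n - 1) \<le> t\<^sub>0 / \<delta> l" "t\<^sub>0 / \<delta> l \<le> real n"
        using t0 \<delta> by (auto simp: n_def) linarith+
      define p where "p = Suc (nat \<lfloor>a / \<delta> l\<rfloor>)"
      have p: "a / \<delta> l < real p" "real p \<le> a / \<delta> l + 1"
        using a \<delta> by (auto simp: p_def) linarith+
      \<comment> \<open>The first \<open>n\<close> sampled times do not exceed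
        \<open>t\<^sub>0\<close>, and no visit falls after \<open>a\<close>, so every sampled visit
        has index below \<open>p\<close>.\<close>
      have "(\<Sum>j<n. indicator A ((\<Psi> (\<delta> l) ^^ j) x) :: real) \<le> (\<Sum>j<n. indicator {..<p} j)"
      proof (rule sum_mono)
        fix j assume j: "j \<in> {..<n}"
        have "real j \<le> t\<^sub>0 / \<delta> l" using n(1) j by (auto simp: n_def)
        then have jt: "real j * \<delta> l \<le> t\<^sub>0" using \<delta> by (simp add: field_simps)
        have "real j < real p" if "\<Psi> (real j * \<delta> l) x \<in> A"
        proof -
          have "real j * \<delta> l \<le> a" using no jt that by force
          then have "real j \<le> a / \<delta> l" using \<delta> by (simp add: field_simps)
          then show ?thesis using p by linarith
        qed
        then show "indicator A ((\<Psi> (\<delta> l) ^^ j) x) \<le> (indicator {..<p} j :: real)"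
          by (auto simp: pow indicator_def)
      qed
      also have "\<dots> = real (card ({..<n} \<inter> {..<p}))" by (simp add: indicator_def sum_of_bool_eq lessThan_def Int_def)
      also have "\<dots> \<le> real p"
        using card_mono[of "{..<p}" "{..<n} \<inter> {..<p}"] by simp
      also have "\<dots> \<le> a / \<delta> l + 1" by (rule p)
      also have "\<dots> \<le> 2 * (a / \<delta> l)" using \<delta> by (simp add: field_simps)
      also have "\<dots> \<le> 2 * (\<theta> * t\<^sub>0 / \<delta> l)"
        using a \<delta> by (intro mult_left_mono divide_right_mono) auto
      also have "\<dots> = 2 * \<theta> * (t\<^sub>0 / \<delta> l)" by simp
      also have "\<dots> \<le> 2 * \<theta> * real n" using n \<open>0 \<le> \<theta>\<close> by (intro mult_left_mono) auto
      finally show ?thesis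
        using x by (auto simp: U_def n_def intro!: exI[of _ n])
    qed
    then have "x \<in> V" by (auto simp: V_def)
    then show False using x by simp
  qed
  ultimately show ?thesis by (rule that)
qed

section \<open>Grid cells and their neighbourhoods\<close>

text \<open>For positive \<open>h\<close> the level sets are half-open cubes of side
  \<open>h\<close>. Naming them by integer vectors makes the cells a countable disjoint family, and
  neighbourhoods become conditions on index differences.\<close>

definition grid_index :: "real \<Rightarrow> real ^ 'n \<Rightarrow> int ^ 'n" where
  "grid_index h z = (\<chi> i. \<lfloor>z $ i / h\<rfloor>)"

text \<open>The cardinality of this box bounds the overlap of the neighbourhoods.\<close>

definition int_box :: "nat \<Rightarrow> (int ^ 'n) set" where
  "int_box m = {d. \<forall>i. \<bar>d $ i\<bar> \<le> int m}"

lemma finite_int_box: "finite (int_box m :: (int ^ 'n::finite) set)"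
proof -
  have "finite ((\<lambda>f. vec_lambda f :: int ^ 'n) ` (UNIV \<rightarrow>\<^sub>E {- int m..int m}))"
    by (intro finite_imageI finite_PiE) auto
  moreover have "int_box m \<subseteq> (\<lambda>f. vec_lambda f :: int ^ 'n) ` (UNIV \<rightarrow>\<^sub>E {- int m..int m})"
  proof
    fix d :: "int ^ 'n" assume "d \<in> int_box m"
    then have "d = vec_lambda (($) d)" "(($) d) \<in> UNIV \<rightarrow>\<^sub>E {- int m..int m}"
      by (auto simp: int_box_def abs_le_iff PiE_UNIV_domain minus_le_iff)
    then show "d \<in> (\<lambda>f. vec_lambda f) ` (UNIV \<rightarrow>\<^sub>E {- int m..int m})" by blast
  qed
  ultimately show ?thesis by (rule rev_finite_subset)
qed

lemma grid_cell_measurable [measurable]: "{z :: real ^ 'n::finite. grid_index h z = k} \<in> sets borel"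
proof -
  have "{z. grid_index h z = k} = (\<Inter>i. {z. \<lfloor>z $ i / h\<rfloor> = k $ i})"
    by (auto simp: grid_index_def vec_eq_iff)
  also have "\<dots> \<in> sets borel" by measurable
  finally show ?thesis .
qed

lemma grid_preimage_measurable:
  fixes f :: "'a \<Rightarrow> real ^ 'n::finite"
  assumes "f \<in> borel_measurable M"
  shows "{x \<in> space M. grid_index h (f x) = k} \<in> sets M"
proof -
  have "{x \<in> space M. grid_index h (f x) = k} = f -` {z. grid_index h z = k} \<inter> space M"
    by auto
  also have "\<dots> \<in> sets M"
    using assms grid_cell_measurable by (rule measurable_sets)
  finally show ?thesis .
qed

text \<open>Coordinates differ by less than \<open>h\<close>, and the Euclidean norm is at most the
  l1 norm; hence the factor \<open>CARD('n)\<close> instead of its square root.\<close>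

lemma dist_grid_cell_less:
  fixes z w :: "real ^ 'n::finite"
  assumes "0 < h" "grid_index h z = grid_index h w"
  shows "dist z w < real CARD('n) * h"
proof -
  have "\<bar>(z - w) $ i\<bar> < h" for i
  proof -
    have "\<lfloor>z $ i / h\<rfloor> = \<lfloor>w $ i / h\<rfloor>"
      using assms(2) by (auto simp: grid_index_def vec_eq_iff)
    then have "\<bar>z $ i / h - w $ i / h\<bar> < 1" by linarith
    then have "\<bar>z $ i / h - w $ i / h\<bar> * h < 1 * h" using assms(1) by (rule mult_strict_right_mono)
    moreover have "\<bar>z $ i / h - w $ i / h\<bar> * h = \<bar>(z $ i / h - w $ i / h) * h\<bar>"
      using assms(1) by (simp add: abs_mult)
    ultimately show ?thesis using assms(1) by (simp add: left_diff_distrib)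
  qed
  then have "(\<Sum>i\<in>UNIV. \<bar>(z - w) $ i\<bar>) < (\<Sum>i\<in>(UNIV :: 'n set). h)"
    by (intro sum_strict_mono) auto
  then show ?thesis
    using norm_le_l1_cart[of "z - w"] by (simp add: dist_norm)
qed

text \<open>A change of less than \<open>m\<close> in a rescaled coordinate moves its floor by at
  most \<open>m\<close>. This puts balls around points of a cell inside its neighbourhood.\<close>

lemma grid_index_diff_in_box:
  fixes z w :: "real ^ 'n::finite"
  assumes "0 < h" "dist z w < real m * h"
  shows "grid_index h w - grid_index h z \<in> int_box m"
proof -
  have "\<bar>\<lfloor>w $ i / h\<rfloor> - \<lfloor>z $ i / h\<rfloor>\<bar> \<le> int m" for i
  proof -
    have "\<bar>(z - w) $ i\<bar> < real m * h"
      using component_le_norm_cart[of "z - w" i] assms(2) by (simp add: dist_norm)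
    then have "\<bar>(z - w) $ i\<bar> / h < real m" using assms(1) by (simp add: field_simps)
    moreover have "\<bar>(z - w) $ i\<bar> / h = \<bar>z $ i / h - w $ i / h\<bar>"
      using assms(1) by (simp add: diff_divide_distrib[symmetric])
    ultimately show ?thesis by linarith
  qed
  then show ?thesis by (simp add: int_box_def grid_index_def)
qed

text \<open>A neighbourhood is the union of the cells \<open>d + k\<close> with \<open>d\<close> in
  the box. For fixed \<open>d\<close> these cells partition the space as \<open>k\<close> varies, so
  each \<open>d\<close> contributes total mass 1.\<close>

lemma (in prob_space) sum_grid_neighbourhoods:
  fixes f :: "'a \<Rightarrow> real ^ 'n::finite"
  assumes f [measurable]: "f \<in> borel_measurable M"
  shows "(\<integral>\<^sup>+k. emeasure M {x \<in> space M. grid_index h (f x) - k \<in> int_box m} \<partial>count_space UNIV)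
    \<le> of_nat (card (int_box m :: (int ^ 'n) set))"
proof -
  define P where "P k = {x \<in> space M. grid_index h (f x) = k}" for k
  have Pm [measurable]: "P k \<in> sets M" for k
    unfolding P_def by (rule grid_preimage_measurable[OF f])
  have "emeasure M {x \<in> space M. grid_index h (f x) - k \<in> int_box m}
      \<le> (\<Sum>d\<in>int_box m. emeasure M (P (d + k)))" for k
  proof -
    have "{x \<in> space M. grid_index h (f x) - k \<in> int_box m} = (\<Union>d\<in>int_box m. P (d + k))"
      by (auto simp: P_def)
    then show ?thesis
      using Pm by (auto intro!: emeasure_subadditive_finite finite_int_box)
  qed
  then have "(\<integral>\<^sup>+k. emeasure M {x \<in> space M. grid_index h (f x) - k \<in> int_box m} \<partial>count_space UNIV)
      \<le> (\<integral>\<^sup>+k. (\<Sum>d\<in>int_box m. emeasure M (P (d + k))) \<partial>count_space UNIV)"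
    by (intro nn_integral_mono) simp
  also have "\<dots> = (\<Sum>d\<in>int_box m. \<integral>\<^sup>+k. emeasure M (P (d + k)) \<partial>count_space UNIV)"
    by (rule nn_integral_sum) simp
  also have "\<dots> = (\<Sum>d\<in>(int_box m :: (int ^ 'n) set). 1)"
  proof (rule sum.cong[OF refl])
    fix d :: "int ^ 'n"
    \<comment> \<open>Translation permutes the index lattice, so the shift by \<open>d\<close> does
      not change the sum.\<close>
    have "bij ((+) d)" by simp
    then have "(\<integral>\<^sup>+k. emeasure M (P (d + k)) \<partial>count_space UNIV) = (\<integral>\<^sup>+k. emeasure M (P k) \<partial>count_space UNIV)"
      by (rule nn_integral_bij_count_space)
    also have "\<dots> = emeasure M (\<Union>k. P k)"
      by (rule emeasure_UN_countable[symmetric]) (use Pm in \<open>auto simp: disjoint_family_on_def P_def\<close>)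
    also have "(\<Union>k. P k) = space M" by (auto simp: P_def)
    finally show "(\<integral>\<^sup>+k. emeasure M (P (d + k)) \<partial>count_space UNIV) = 1"
      by (simp add: emeasure_space_1)
  qed
  finally show ?thesis by simp
qed

section \<open>Returns at one dyadic scale and at all small scales\<close>

lemma flow_return_at_scale:
  fixes \<Psi> :: "real \<Rightarrow> 'a \<Rightarrow> 'a" and f :: "'a \<Rightarrow> real ^ 'n::finite"
    and R c :: real
  assumes "prob_space M" and \<Psi>: "\<And>t. \<Psi> t \<in> measurable M M" and inv: "\<And>t. distr M M (\<Psi> t) = M"
    and \<Psi>0: "\<And>x. \<Psi> 0 x = x" and \<Psi>add: "\<And>s t x. \<Psi> (s + t) x = \<Psi> s (\<Psi> t x)"
    and f [measurable]: "f \<in> borel_measurable M" and "0 < R" and "0 \<le> c"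
  obtains W where "W \<in> sets M"
    "emeasure M W \<le> ennreal (2 * c * card (int_box (2 * CARD('n)) :: (int ^ 'n) set))"
    "\<And>x r a t\<^sub>0. x \<in> space M - W \<Longrightarrow> R / 2 < r \<Longrightarrow> r \<le> R \<Longrightarrow> 0 < a \<Longrightarrow>
      a \<le> c * measure (distr M borel f) (ball (f x) r) * t\<^sub>0 \<Longrightarrow>
      \<exists>t. a < t \<and> t \<le> t\<^sub>0 \<and> f (\<Psi> t x) \<in> ball (f x) r"
proof -
  interpret prob_space M by fact
  \<comment> \<open>One grid serves all radii between \<open>R / 2\<close> and \<open>R\<close>:
    points of a cell are closer than \<open>R / 2 < r\<close>, so a return to the cell is a return
    to the ball, and the neighbourhood reaches out to \<open>m * h = R\<close>, so it contains the
    ball.\<close>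
  define h where "h = R / (2 * real CARD('n))"
  define m where "m = 2 * CARD('n)"
  have h: "0 < h" "real CARD('n) * h = R / 2" "real m * h = R"
    using \<open>0 < R\<close> by (auto simp: h_def m_def)
  define A where "A k = {x \<in> space M. grid_index h (f x) = k}" for k
  have Am [measurable]: "A k \<in> sets M" for k
    unfolding A_def by (rule grid_preimage_measurable[OF f])
  define N where "N k = {x \<in> space M. grid_index h (f x) - k \<in> int_box m}" for k
  have Nm [measurable]: "N k \<in> sets M" for k
  proof -
    have "N k = (\<Union>d\<in>int_box m. A (d + k))"
      by (auto simp: N_def A_def)
    then show ?thesis by (simp add: finite_int_box sets.finite_UN)
  qed
  have "\<exists>V. V \<in> sets M \<and> V \<subseteq> A k \<and> emeasure M V \<le> ennreal (2 * (c * prob (N k))) \<and>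
      (\<forall>x a t\<^sub>0. x \<in> A k - V \<longrightarrow> 0 < a \<longrightarrow> a \<le> c * prob (N k) * t\<^sub>0 \<longrightarrow>
        (\<exists>t. a < t \<and> t \<le> t\<^sub>0 \<and> \<Psi> t x \<in> A k))" for k
  proof -
    have "0 \<le> c * prob (N k)" using \<open>0 \<le> c\<close> by simp
    then show ?thesis
      by (rule flow_return_outside_small_set[OF \<open>prob_space M\<close> \<Psi> inv \<Psi>0 \<Psi>add Am[of k]]) blast
  qed
  then obtain V where Vm [measurable]: "\<And>k. V k \<in> sets M" and VA: "\<And>k. V k \<subseteq> A k"
    and Vle: "\<And>k. emeasure M (V k) \<le> ennreal (2 * (c * prob (N k)))"
    and V: "\<And>k x a t\<^sub>0. x \<in> A k - V k \<Longrightarrow> 0 < a \<Longrightarrow> a \<le> c * prob (N k) * t\<^sub>0 \<Longrightarrow>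
      \<exists>t. a < t \<and> t \<le> t\<^sub>0 \<and> \<Psi> t x \<in> A k"
    by metis
  define W where "W = (\<Union>k. V k)"
  have "W \<in> sets M" unfolding W_def by (intro sets.countable_UN'') auto
  moreover have "emeasure M W \<le> ennreal (2 * c * card (int_box (2 * CARD('n)) :: (int ^ 'n) set))"
  proof -
    have "disjoint_family V"
      unfolding disjoint_family_on_def
    proof (intro ballI impI)
      show "V j \<inter> V k = {}" if "j \<noteq> k" for j k
        using VA[of j] VA[of k] that by (auto simp: A_def)
    qed
    then have "emeasure M W = (\<integral>\<^sup>+k. emeasure M (V k) \<partial>count_space UNIV)"
      unfolding W_def by (intro emeasure_UN_countable) auto
    \<comment> \<open>Each exceptional piece is bounded in proportion to the mass of its
      neighbourhood, so bounded overlap makes the total independent of \<open>R\<close>.\<close>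
    also have "\<dots> \<le> (\<integral>\<^sup>+k. ennreal (2 * c) * emeasure M (N k) \<partial>count_space UNIV)"
    proof (rule nn_integral_mono)
      show "emeasure M (V k) \<le> ennreal (2 * c) * emeasure M (N k)" for k
        using Vle[of k] \<open>0 \<le> c\<close> by (simp add: emeasure_eq_measure ennreal_mult[symmetric] mult.assoc)
    qed
    also have "\<dots> = ennreal (2 * c) * (\<integral>\<^sup>+k. emeasure M (N k) \<partial>count_space UNIV)"
      by (rule nn_integral_cmult) simp
    also have "\<dots> \<le> ennreal (2 * c) * of_nat (card (int_box m :: (int ^ 'n) set))"
      unfolding N_def by (intro mult_left_mono sum_grid_neighbourhoods f) simp
    finally show ?thesis
      using \<open>0 \<le> c\<close> by (simp add: m_def ennreal_mult ennreal_of_nat_eq_real_of_nat)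
  qed
  moreover have "\<exists>t. a < t \<and> t \<le> t\<^sub>0 \<and> f (\<Psi> t x) \<in> ball (f x) r"
    if x: "x \<in> space M - W" and r: "R / 2 < r" "r \<le> R" and a: "0 < a"
      "a \<le> c * measure (distr M borel f) (ball (f x) r) * t\<^sub>0" for x r a t\<^sub>0
  proof -
    define k where "k = grid_index h (f x)"
    have ball: "measure (distr M borel f) (ball (f x) r) \<le> prob (N k)"
    proof -
      have "measure (distr M borel f) (ball (f x) r) = prob (f -` ball (f x) r \<inter> space M)"
        by (simp add: measure_distr)
      also have "\<dots> \<le> prob (N k)"
      proof (rule finite_measure_mono[OF _ Nm])
        show "f -` ball (f x) r \<inter> space M \<subseteq> N k"
          using r h by (auto simp: N_def k_def intro!: grid_index_diff_in_box)
      qed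
      finally show ?thesis .
    qed
    \<comment> \<open>Positivity, forced by \<open>0 < a\<close>, lets the larger mass of
      \<open>N k\<close> replace that of the ball in the bound on \<open>a\<close>.\<close>
    have "0 < t\<^sub>0"
      using a \<open>0 \<le> c\<close> by (metis less_le_trans measure_nonneg mult_nonneg_nonneg mult_nonneg_nonpos not_le)
    then have "c * measure (distr M borel f) (ball (f x) r) * t\<^sub>0 \<le> c * prob (N k) * t\<^sub>0"
      using ball \<open>0 \<le> c\<close> by (intro mult_right_mono mult_left_mono) auto
    then have "a \<le> c * prob (N k) * t\<^sub>0" using a by linarith
    moreover have "x \<in> A k - V k" using x by (auto simp: W_def A_def k_def)
    ultimately obtain t where t: "a < t" "t \<le> t\<^sub>0" "\<Psi> t x \<in> A k" using V a(1) by blast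
    have "dist (f x) (f (\<Psi> t x)) < r"
      using dist_grid_cell_less[OF h(1), of "f x" "f (\<Psi> t x)"] t(3) r h(2) by (simp add: A_def k_def)
    then show ?thesis using t by auto
  qed
  ultimately show ?thesis by (rule that)
qed

text \<open>With \<open>c\<close> equal to \<open>R n powr \<epsilon>\<close> the exceptional masses
  are dominated by a geometric series, so Borel-Cantelli applies. Both \<open>a\<close> and
  \<open>t\<^sub>0\<close> are quantified inside the almost-everywhere statement, so that values
  depending on \<open>x\<close> and \<open>r\<close> can be inserted pointwise.\<close>

lemma AE_flow_return:
  fixes \<Psi> :: "real \<Rightarrow> 'a \<Rightarrow> 'a" and f :: "'a \<Rightarrow> real ^ 'n::finite"
  assumes "prob_space M" and \<Psi>: "\<And>t. \<Psi> t \<in> measurable M M" and inv: "\<And>t. distr M M (\<Psi> t) = M"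
    and \<Psi>0: "\<And>x. \<Psi> 0 x = x" and \<Psi>add: "\<And>s t x. \<Psi> (s + t) x = \<Psi> s (\<Psi> t x)"
    and f: "f \<in> borel_measurable M" and "0 < \<epsilon>"
  shows "AE x in M. \<forall>\<^sub>F r in at_right 0. \<forall>a t\<^sub>0. 0 < a \<longrightarrow>
      a \<le> r powr \<epsilon> * measure (distr M borel f) (ball (f x) r) * t\<^sub>0 \<longrightarrow>
      (\<exists>t. a < t \<and> t \<le> t\<^sub>0 \<and> f (\<Psi> t x) \<in> ball (f x) r)"
proof -
  interpret prob_space M by fact
  define R :: "nat \<Rightarrow> real" where "R n = (1 / 2) ^ n" for n
  define C where "C = real (card (int_box (2 * CARD('n)) :: (int ^ 'n) set))"
  have "\<exists>W. W \<in> sets M \<and> emeasure M W \<le> ennreal (2 * R n powr \<epsilon> * C) \<and>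
      (\<forall>x r a t\<^sub>0. x \<in> space M - W \<longrightarrow> R n / 2 < r \<longrightarrow> r \<le> R n \<longrightarrow> 0 < a \<longrightarrow>
        a \<le> R n powr \<epsilon> * measure (distr M borel f) (ball (f x) r) * t\<^sub>0 \<longrightarrow>
        (\<exists>t. a < t \<and> t \<le> t\<^sub>0 \<and> f (\<Psi> t x) \<in> ball (f x) r))" for n
  proof -
    have "0 < R n" "0 \<le> R n powr \<epsilon>" by (simp_all add: R_def)
    then show ?thesis
      unfolding C_def
      by (rule flow_return_at_scale[OF \<open>prob_space M\<close> \<Psi> inv \<Psi>0 \<Psi>add f]) blast
  qed
  then obtain W where Wm: "\<And>n. W n \<in> sets M"
    and Wle: "\<And>n. emeasure M (W n) \<le> ennreal (2 * R n powr \<epsilon> * C)"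
    and W: "\<And>n x r a t\<^sub>0. x \<in> space M - W n \<Longrightarrow> R n / 2 < r \<Longrightarrow> r \<le> R n \<Longrightarrow> 0 < a \<Longrightarrow>
        a \<le> R n powr \<epsilon> * measure (distr M borel f) (ball (f x) r) * t\<^sub>0 \<Longrightarrow>
        \<exists>t. a < t \<and> t \<le> t\<^sub>0 \<and> f (\<Psi> t x) \<in> ball (f x) r"
    by metis
  have "summable (\<lambda>n. measure M (W n))"
  proof (rule summable_comparison_test')
    have "(1 / 2 :: real) powr \<epsilon> < 1 powr \<epsilon>"
      using \<open>0 < \<epsilon>\<close> by (intro powr_less_mono2) auto
    then have "summable (\<lambda>n. ((1 / 2 :: real) powr \<epsilon>) ^ n)"
      by (intro summable_geometric) simp
    then show "summable (\<lambda>n. 2 * C * ((1 / 2) powr \<epsilon>) ^ n)"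
      by (rule summable_mult)
    have "R n powr \<epsilon> = ((1 / 2) powr \<epsilon>) ^ n" for n
      unfolding R_def by (simp add: powr_power[symmetric] powr_realpow[symmetric] powr_powr mult.commute)
    then show "norm (measure M (W n)) \<le> 2 * C * ((1 / 2) powr \<epsilon>) ^ n" for n
      using Wle[of n] by (simp add: emeasure_eq_measure C_def mult_ac)
  qed
  then have "AE x in M. \<forall>\<^sub>F n in sequentially. x \<in> space M - W n"
    using Wm by (intro borel_cantelli_AE1) (auto simp: less_top[symmetric])
  then show ?thesis
  proof (rule AE_mp, intro AE_I2 impI)
    fix x assume "\<forall>\<^sub>F n in sequentially. x \<in> space M - W n"
    then obtain n\<^sub>0 where n0: "\<And>n. n \<ge> n\<^sub>0 \<Longrightarrow> x \<in> space M - W n"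
      by (auto simp: eventually_sequentially)
    have "\<forall>\<^sub>F r in at_right 0. r < R n\<^sub>0 \<and> r < 1 \<and> 0 < r"
      unfolding eventually_at_right_field by (intro exI[of _ "R n\<^sub>0"]) (auto simp: R_def power_le_one intro: less_le_trans)
    then show "\<forall>\<^sub>F r in at_right 0. \<forall>a t\<^sub>0. 0 < a \<longrightarrow>
      a \<le> r powr \<epsilon> * measure (distr M borel f) (ball (f x) r) * t\<^sub>0 \<longrightarrow>
      (\<exists>t. a < t \<and> t \<le> t\<^sub>0 \<and> f (\<Psi> t x) \<in> ball (f x) r)"
    proof (rule eventually_mono, intro allI impI)
      fix r a t\<^sub>0 :: real
      assume r: "r < R n\<^sub>0 \<and> r < 1 \<and> 0 < r" and a: "0 < a"
        "a \<le> r powr \<epsilon> * measure (distr M borel f) (ball (f x) r) * t\<^sub>0"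
      obtain k where "R k < r"
        using real_arch_pow_inv[of r "1 / 2"] r by (auto simp: R_def)
      moreover have "R (Suc k) \<le> R k" by (simp add: R_def)
      ultimately have "R (Suc k) < r" by simp
      \<comment> \<open>Minimality places \<open>r\<close> in the dyadic interval from
        \<open>R (Suc n)\<close>, which is \<open>R n / 2\<close>, to \<open>R n\<close>; for
        \<open>n = 0\<close> the upper bound comes from \<open>r < 1\<close>.\<close>
      define n where "n = (LEAST k. R (Suc k) < r)"
      have n: "R (Suc n) < r" unfolding n_def by (rule LeastI) fact
      have n': "r \<le> R n"
      proof (cases n)
        case 0
        then show ?thesis using r by (simp add: R_def)
      next
        case (Suc i)
        then have "\<not> R (Suc i) < r" unfolding n_def by (intro not_less_Least) simp
        then show ?thesis using Suc by simp
      qed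
      have "n\<^sub>0 \<le> n"
      proof (rule ccontr)
        assume "\<not> n\<^sub>0 \<le> n"
        then have "R n\<^sub>0 \<le> R (Suc n)" unfolding R_def by (intro power_decreasing) auto
        then show False using r n by simp
      qed
      moreover have "a \<le> R n powr \<epsilon> * measure (distr M borel f) (ball (f x) r) * t\<^sub>0"
      proof -
        have "0 < t\<^sub>0"
          using a by (metis less_le_trans measure_nonneg mult_nonneg_nonneg mult_nonneg_nonpos not_le powr_ge_zero)
        moreover have "r powr \<epsilon> \<le> R n powr \<epsilon>" using n' r \<open>0 < \<epsilon>\<close> by (intro powr_mono2) auto
        ultimately have "r powr \<epsilon> * measure (distr M borel f) (ball (f x) r) * t\<^sub>0
            \<le> R n powr \<epsilon> * measure (distr M borel f) (ball (f x) r) * t\<^sub>0"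
          by (intro mult_right_mono) auto
        then show ?thesis using a by linarith
      qed
      ultimately show "\<exists>t. a < t \<and> t \<le> t\<^sub>0 \<and> f (\<Psi> t x) \<in> ball (f x) r"
        using W[OF n0, of n r a t\<^sub>0] n n' a by (simp add: R_def)
    qed
  qed
qed

section \<open>Positive ball masses and passage to recurrence rates\<close>

text \<open>The null members of a countable basis have a null union. Outside it, every ball around a
  point contains a basic set of positive measure around that point.\<close>

lemma AE_measure_ball_pos:
  fixes \<mu> :: "'a::{metric_space, second_countable_topology} measure"
  assumes "finite_measure \<mu>" and [measurable_cong]: "sets \<mu> = sets borel"
  shows "AE z in \<mu>. \<forall>r>0. 0 < measure \<mu> (ball z r)"
proof -
  interpret finite_measure \<mu> by fact
  obtain \<B> :: "'a set set" where \<B>: "countable \<B>" "topological_basis \<B>"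
    using ex_countable_basis by blast
  have "AE z in \<mu>. \<forall>b\<in>\<B>. measure \<mu> b = 0 \<longrightarrow> z \<notin> b"
  proof (subst AE_ball_countable[OF \<B>(1)], intro ballI)
    fix b assume "b \<in> \<B>"
    then have "b \<in> sets \<mu>" using topological_basis_open[OF \<B>(2)] assms(2) by auto
    then show "AE z in \<mu>. measure \<mu> b = 0 \<longrightarrow> z \<notin> b"
      by (cases "measure \<mu> b = 0") (auto intro!: AE_not_in simp: emeasure_eq_measure null_sets_def)
  qed
  then show ?thesis
  proof (rule AE_mp, intro AE_I2 impI allI)
    fix z and r :: real
    assume z: "\<forall>b\<in>\<B>. measure \<mu> b = 0 \<longrightarrow> z \<notin> b" and "0 < r"
    then obtain b where b: "b \<in> \<B>" "z \<in> b" "b \<subseteq> ball z r"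
      using topological_basisE[OF \<B>(2), of "ball z r" z] by auto
    have "0 < measure \<mu> b" using z b by (metis measure_nonneg order_le_less)
    also have "\<dots> \<le> measure \<mu> (ball z r)"
      using b assms(2) by (intro finite_measure_mono) auto
    finally show "0 < measure \<mu> (ball z r)" .
  qed
qed

lemma elog_le_ln:
  assumes "\<tau> \<le> ereal t" and "0 < t"
  shows "elog \<tau> \<le> ereal (ln t)"
  using assms by (cases \<tau>) (auto simp: elog_def)

lemma return_time_exponent_le:
  assumes "0 < r" "r < 1" "0 < \<rho> r (f x)" "0 < b"
    and ret: "\<And>t\<^sub>0. \<rho> r (f x) \<le> r powr \<epsilon> * b * t\<^sub>0 \<Longrightarrow>
      \<exists>t. \<rho> r (f x) < t \<and> t \<le> t\<^sub>0 \<and> f (\<Psi> t x) \<in> ball (f x) r"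
  shows "elog (return_time \<Psi> f \<rho> r x) / ereal (- ln r)
    \<le> ereal (ln b / ln r - ln (\<rho> r (f x)) / ln r) + ereal \<epsilon>"
proof -
  define a where "a = \<rho> r (f x)"
  \<comment> \<open>This is the least time that \<open>ret\<close> admits. Its logarithm divided by
    \<open>- ln r\<close> yields the two quotients, and the factor \<open>r powr \<epsilon>\<close>
    yields the summand \<open>\<epsilon>\<close>.\<close>
  define t\<^sub>0 where "t\<^sub>0 = a / (r powr \<epsilon> * b)"
  have a: "0 < a" using assms by (simp add: a_def)
  have "a \<le> r powr \<epsilon> * b * t\<^sub>0" using assms by (simp add: t\<^sub>0_def)
  then obtain t where t: "a < t" "t \<le> t\<^sub>0" "f (\<Psi> t x) \<in> ball (f x) r"
    using ret unfolding a_def by blast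
  have "return_time \<Psi> f \<rho> r x \<le> ereal t"
    unfolding return_time_def by (rule INF_lower) (use t in \<open>simp add: a_def\<close>)
  also have "\<dots> \<le> ereal t\<^sub>0" using t by simp
  finally have "elog (return_time \<Psi> f \<rho> r x) \<le> ereal (ln t\<^sub>0)"
    using a t by (intro elog_le_ln) auto
  then have "elog (return_time \<Psi> f \<rho> r x) / ereal (- ln r) \<le> ereal (ln t\<^sub>0) / ereal (- ln r)"
    using assms by (intro ereal_divide_right_mono) auto
  also have "\<dots> = ereal (ln t\<^sub>0 / (- ln r))" using assms by simp
  also have "ln t\<^sub>0 = ln a - (\<epsilon> * ln r + ln b)"
    using assms a by (simp add: t\<^sub>0_def ln_div ln_mult ln_powr)
  also have "(ln a - (\<epsilon> * ln r + ln b)) / (- ln r) = ln b / ln r - ln a / ln r + \<epsilon>"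
    using assms by (simp add: field_simps)
  finally show ?thesis by (simp add: a_def)
qed

theorem theorem2p4:
  fixes A :: "('m::{t2_space, second_countable_topology}, 'd::finite) chart set"
    and g :: "('m, 'd) chart \<Rightarrow> real ^ 'd \<Rightarrow> real ^ 'd \<Rightarrow> real ^ 'd \<Rightarrow> real"
    and \<Psi> :: "real \<Rightarrow> 'm \<Rightarrow> 'm"
    and \<nu> :: "'m measure"
    and f :: "'m \<Rightarrow> real ^ 'n::finite"
    and \<rho> :: "real \<Rightarrow> real ^ 'n \<Rightarrow> real"
  assumes "riemannian_manifold A g"
    and "measurable_flow \<Psi>"
    and "prob_space \<nu>" and "sets \<nu> = sets borel"
    and "flow_invariant \<Psi> \<nu>"
    and "f \<in> borel_measurable borel"
    and "escape_function (distr \<nu> borel f) \<rho>"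
  shows "AE x in \<nu>.
      lower_recurrence_rate \<Psi> f \<rho> x \<le>
        Liminf (at_right 0) (\<lambda>r. ereal (ln (measure (distr \<nu> borel f) (ball (f x) r)) / ln r
                                        - ln (\<rho> r (f x)) / ln r)) \<and>
      upper_recurrence_rate \<Psi> f \<rho> x \<le>
        Limsup (at_right 0) (\<lambda>r. ereal (ln (measure (distr \<nu> borel f) (ball (f x) r)) / ln r
                                        - ln (\<rho> r (f x)) / ln r))"
proof -
  interpret prob_space \<nu> by fact
  have \<Psi>0: "\<Psi> 0 x = x" and \<Psi>add: "\<Psi> (s + t) x = \<Psi> s (\<Psi> t x)" for s t x
    using assms(2) by (auto simp: measurable_flow_def)
  have \<Psi>m: "\<Psi> t \<in> measurable \<nu> \<nu>" for t
  proof -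
    have "(\<lambda>(t, x). \<Psi> t x) \<circ> Pair t \<in> borel \<rightarrow>\<^sub>M borel"
      using assms(2) by (intro measurable_comp[where N = "borel \<Otimes>\<^sub>M borel"]) (auto simp: measurable_flow_def)
    then show ?thesis
      by (simp add: o_def measurable_cong_sets[OF assms(4) assms(4)])
  qed
  have inv: "distr \<nu> \<nu> (\<Psi> t) = \<nu>" for t
    using assms(5) by (simp add: flow_invariant_def)
  have f [measurable]: "f \<in> borel_measurable \<nu>"
    using assms(6) by (simp add: measurable_cong_sets[OF assms(4) refl])
  define \<mu> where "\<mu> = distr \<nu> borel f"
  interpret \<mu>: prob_space \<mu> unfolding \<mu>_def by (rule prob_space_distr) simp
  have "AE z in \<mu>. \<forall>r>0. 0 < measure \<mu> (ball z r)"
    by (rule AE_measure_ball_pos) (auto simp: \<mu>_def \<mu>.finite_measure_axioms[unfolded \<mu>_def])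
  then have pos: "AE x in \<nu>. \<forall>r>0. 0 < measure \<mu> (ball (f x) r)"
    unfolding \<mu>_def by (rule AE_distrD[OF f])
  \<comment> \<open>Restricting the exponents to \<open>1 / real (Suc k)\<close> leaves countably
    many null sets, so one null set serves all of them.\<close>
  have "AE x in \<nu>. \<forall>k. \<forall>\<^sub>F r in at_right 0. \<forall>a t\<^sub>0. 0 < a \<longrightarrow>
      a \<le> r powr (1 / real (Suc k)) * measure \<mu> (ball (f x) r) * t\<^sub>0 \<longrightarrow>
      (\<exists>t. a < t \<and> t \<le> t\<^sub>0 \<and> f (\<Psi> t x) \<in> ball (f x) r)"
    unfolding AE_all_countable \<mu>_def
    by (intro allI AE_flow_return prob_space_axioms \<Psi>m inv \<Psi>0 \<Psi>add f) simp
  then show ?thesis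
    using pos
  proof eventually_elim
    case (elim x)
    define q where "q r = ereal (ln (measure \<mu> (ball (f x) r)) / ln r - ln (\<rho> r (f x)) / ln r)" for r
    define p where "p r = elog (return_time \<Psi> f \<rho> r x) / ereal (- ln r)" for r
    have \<rho>: "\<forall>\<^sub>F r in at_right 0. 0 < \<rho> r (f x)"
      using assms(7) by (simp add: escape_function_def)
    have r: "\<forall>\<^sub>F r in at_right (0::real). 0 < r \<and> r < 1"
      unfolding eventually_at_right_field by (intro exI[of _ 1]) simp
    have le: "\<forall>\<^sub>F r in at_right 0. p r \<le> q r + ereal (1 / real (Suc k))" for k
      using elim(1)[rule_format, of k] \<rho> r
    proof eventually_elim
      case (elim r)
      then show ?case
        unfolding p_def q_def using \<open>\<forall>r>0. 0 < measure \<mu> (ball (f x) r)\<close>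
        by (intro return_time_exponent_le) auto
    qed
    have eps: "a \<le> b" if "\<And>k. a \<le> b + ereal (1 / real (Suc k))" for a b :: ereal
    proof (rule ereal_le_epsilon2)
      fix e :: real assume "0 < e"
      then obtain k where "1 / real (Suc k) < e"
        using reals_Archimedean by (auto simp: inverse_eq_divide)
      then have "b + ereal (1 / real (Suc k)) \<le> b + ereal e" by (intro add_left_mono) simp
      then show "a \<le> b + ereal e" using that[of k] by (rule order_trans[rotated])
    qed
    \<comment> \<open>A finite constant passes through \<open>Liminf\<close> and
      \<open>Limsup\<close>, so the loss \<open>1 / real (Suc k)\<close> can be sent to 0 after
      taking the limit in \<open>r\<close>.\<close>
    have "Liminf (at_right 0) p \<le> Liminf (at_right 0) q"
    proof (rule eps)
      show "Liminf (at_right 0) p \<le> Liminf (at_right 0) q + ereal (1 / real (Suc k))" for k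
        using Liminf_mono[OF le[of k]] by (simp add: Liminf_add_ereal_right)
    qed
    moreover have "Limsup (at_right 0) p \<le> Limsup (at_right 0) q"
    proof (rule eps)
      show "Limsup (at_right 0) p \<le> Limsup (at_right 0) q + ereal (1 / real (Suc k))" for k
        using Limsup_mono[OF le[of k]] by (simp add: Limsup_add_ereal_right)
    qed
    ultimately show ?case
      unfolding lower_recurrence_rate_def upper_recurrence_rate_def p_def q_def \<mu>_def by simp
  qed
qed

end
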